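(* Let $u_1,\dots,u_{m_1}\in\mathbb{R}^{n_1}$ be linearly independent and let $v_1,\dots,v_{m_2}\in\mathbb{R}^{n_2}$ be linearly independent. Let $P_1\in\mathbb{R}^{m_1m_2\times n_1}$ and $P_2\in\mathbb{R}^{m_1m_2\times n_2}$ be the matrices produced by the TEIM algorithm applied to $U=[u_1\ \cdots\ u_{m_1}]$ and $V=[v_1\ \cdots\ v_{m_2}]$. Then there exist $P_3\in\mathbb{R}^{m_1\times n_1}$ and $P_4\in\mathbb{R}^{m_2\times n_2}$ such that $$P_1^T\otimes_{kr}P_2^T=P_3^T\otimes_k P_4^T,$$ and $$P_3^T(:,i)=P_1^T(:,(i-1)m_2+1)\quad (i\in\{1,\dots,m_1\}),\qquad P_4^T(:,j)=P_2^T(:,j)\quad (j\in\{1,\dots,m_2\}).$$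
   Context: Notation. $\otimes_k$ is the Kronecker product and $\otimes_{kr}$ the column-wise Khatri--Rao product: for $A=[a_1\cdots a_N]$ and $B=[b_1\cdots b_N]$ with the same number of columns, $A\otimes_{kr}B=[a_1\otimes_k b_1\ \cdots\ a_N\otimes_k b_N]$. $A(:,i)$ is the $i$-th column of $A$. $e_p$ is the $p$-th standard unit vector of the appropriate dimension, and $w(p)$ is the $p$-th entry of a vector $w$. Here $m_1\le n_1$ and $m_2\le n_2$ are positive integers. TEIM algorithm. It selects index pairs $(p_t,q_t)\in\{1,\dots,n_1\}\times\{1,\dots,n_2\}$ for $t=1,\dots,m_1m_2$, where iteration $t=(k-1)m_2+l$ corresponds to $k\in\{1,\dots,m_1\}$ (outer loop) and $l\in\{1,\dots,m_2\}$ (inner loop), and treats the rank-one matrix $B_t=u_kv_l^T\in\mathbb{R}^{n_1\times n_2}$. For $t=1$: $(p_1,q_1)=\operatorname{argmax}_{(i,j)}|(u_1v_1^T)_{ij}|$. For $t\ge 2$: let $c\in\mathbb{R}^{t-1}$ be the solution of the linear system $\sum_{s'=1}^{t-1}(B_{s'})_{p_sq_s}\,c_{s'}=(B_t)_{p_sq_s}$, $s=1,\dots,t-1$; put $R_t=B_t-\sum_{s'=1}^{t-1}c_{s'}B_{s'}$; and set $(p_t,q_t)=\operatorname{argmax}_{(i,j)}|(R_t)_{ij}|$. (These systems are uniquely solvable by the linear independence of the inputs.) Whenever the maximum is attained at several positions, argmax denotes the first maximizing position in column-major order (smallest column index, then smallest row index). The output is $P_1^T=[e_{p_1}\ e_{p_2}\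 \cdots\ e_{p_{m_1m_2}}]\in\mathbb{R}^{n_1\times m_1m_2}$ and $P_2^T=[e_{q_1}\ e_{q_2}\ \cdots\ e_{q_{m_1m_2}}]\in\mathbb{R}^{n_2\times m_1m_2}$. *)

theory Defs
  imports "Jordan_Normal_Form.VS_Connect"
begin

text \<open>
  All indices are 0-based: the 1-based iteration \<open>t = (k-1) m2 + l\<close> becomes \<open>t = k * m2 + l\<close>
  with \<open>k < m1\<close> and \<open>l < m2\<close>.
\<close>

text \<open>A family of vectors is represented by the columns of a matrix. The library's independence
  predicate concerns sets, so a repeated column must be excluded separately.\<close>

definition lin_indpt_cols :: "real mat \<Rightarrow> bool" where
  "lin_indpt_cols A \<longleftrightarrow> distinct (cols A) \<and>
     LinearCombinations.module.lin_indpt class_ring (module_vec TYPE(real) (dim_row A)) (set (cols A))"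

definition kron_vec :: "real vec \<Rightarrow> real vec \<Rightarrow> real vec" where
  "kron_vec a b = vec (dim_vec a * dim_vec b) (\<lambda>i. a $ (i div dim_vec b) * b $ (i mod dim_vec b))"

definition kron_mat :: "real mat \<Rightarrow> real mat \<Rightarrow> real mat" where
  "kron_mat A B = mat (dim_row A * dim_row B) (dim_col A * dim_col B)
     (\<lambda>(i, j). A $$ (i div dim_row B, j div dim_col B) * B $$ (i mod dim_row B, j mod dim_col B))"

text \<open>Meaningful only when \<open>A\<close> and \<open>B\<close> have the same number of columns.\<close>

definition khatri_rao :: "real mat \<Rightarrow> real mat \<Rightarrow> real mat" where
  "khatri_rao A B = mat_of_cols (dim_row A * dim_row B)
     (map (\<lambda>i. kron_vec (col A i) (col B i)) [0..<dim_col A])"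

lemma kron_mat_single_cols:
  assumes "a \<in> carrier_vec n" and "b \<in> carrier_vec m"
  shows "kron_mat (mat_of_cols n [a]) (mat_of_cols m [b]) = mat_of_cols (n * m) [kron_vec a b]"
proof (rule eq_matI)
  fix i j
  assume "i < dim_row (mat_of_cols (n * m) [kron_vec a b])"
    and "j < dim_col (mat_of_cols (n * m) [kron_vec a b])"
  then have i: "i < n * m" and j: "j = 0" by auto
  then have "0 < m" by (cases m) auto
  with i have "i div m < n" "i mod m < m" by (auto simp: less_mult_imp_div_less)
  with i j assms show "kron_mat (mat_of_cols n [a]) (mat_of_cols m [b]) $$ (i, j) =
      mat_of_cols (n * m) [kron_vec a b] $$ (i, j)"
    by (auto simp: kron_mat_def kron_vec_def mat_of_cols_def)
qed (auto simp: kron_mat_def)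

definition abs_maximizers :: "real mat \<Rightarrow> (nat \<times> nat) set" where
  "abs_maximizers A = {(i, j). i < dim_row A \<and> j < dim_col A \<and>
     (\<forall>i' < dim_row A. \<forall>j' < dim_col A. \<bar>A $$ (i', j')\<bar> \<le> \<bar>A $$ (i, j)\<bar>)}"

definition abs_argmax :: "real mat \<Rightarrow> nat \<times> nat" where
  "abs_argmax A =
     (let q = (LEAST j. \<exists>i. (i, j) \<in> abs_maximizers A);
          p = (LEAST i. (i, q) \<in> abs_maximizers A)
      in (p, q))"

definition teim_mat :: "real mat \<Rightarrow> real mat \<Rightarrow> nat \<Rightarrow> real mat" where
  "teim_mat U V t = mat (dim_row U) (dim_row V)
     (\<lambda>(i, j). col U (t div dim_col V) $ i * col V (t mod dim_col V) $ j)"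

text \<open>\<open>ps\<close> lists the \<open>t\<close> index pairs selected so far.\<close>

definition teim_coeffs :: "real mat \<Rightarrow> real mat \<Rightarrow> nat \<Rightarrow> (nat \<times> nat) list \<Rightarrow> real vec" where
  "teim_coeffs U V t ps = (THE c. c \<in> carrier_vec t \<and>
     (\<forall>s < t. (\<Sum>s' < t. teim_mat U V s' $$ (ps ! s) * c $ s') = teim_mat U V t $$ (ps ! s)))"

definition teim_residual :: "real mat \<Rightarrow> real mat \<Rightarrow> nat \<Rightarrow> (nat \<times> nat) list \<Rightarrow> real mat" where
  "teim_residual U V t ps = mat (dim_row U) (dim_row V)
     (\<lambda>ij. teim_mat U V t $$ ij - (\<Sum>s' < t. teim_coeffs U V t ps $ s' * teim_mat U V s' $$ ij))"

fun teim_indices :: "real mat \<Rightarrow> real mat \<Rightarrow> nat \<Rightarrow> (nat \<times> nat) list" where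
  "teim_indices U V 0 = []"
| "teim_indices U V (Suc 0) = [abs_argmax (teim_mat U V 0)]"
| "teim_indices U V (Suc (Suc t)) =
     (let ps = teim_indices U V (Suc t) in ps @ [abs_argmax (teim_residual U V (Suc t) ps)])"

definition teim_P1 :: "real mat \<Rightarrow> real mat \<Rightarrow> real mat" where
  "teim_P1 U V = transpose_mat (mat_of_cols (dim_row U)
     (map (\<lambda>(p, q). unit_vec (dim_row U) p) (teim_indices U V (dim_col U * dim_col V))))"

definition teim_P2 :: "real mat \<Rightarrow> real mat \<Rightarrow> real mat" where
  "teim_P2 U V = transpose_mat (mat_of_cols (dim_row V)
     (map (\<lambda>(p, q). unit_vec (dim_row V) q) (teim_indices U V (dim_col U * dim_col V))))"

end

theory Submission
  imports Defs "Jordan_Normal_Form.DL_Rank"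
begin

text \<open>
  Greedy selection on the columns of \<open>U\<close> alone produces residuals \<open>r\<^sub>k = u\<^sub>k - \<Sum>\<^sub>i\<^sub><\<^sub>k c\<^sub>i u\<^sub>i\<close> vanishing at
  the earlier points \<open>p\<^sub>i\<close>, and likewise \<open>s\<^sub>l\<close> with points \<open>q\<^sub>j\<close> for \<open>V\<close>. The rank-one matrix
  \<open>r\<^sub>k s\<^sub>l\<^sup>T\<close> is \<open>u\<^sub>k v\<^sub>l\<^sup>T\<close> minus a combination of earlier \<open>u\<^sub>i v\<^sub>j\<^sup>T\<close>, and it vanishes at every
  earlier pair \<open>(p\<^sub>i, q\<^sub>j)\<close>; by uniqueness of the interpolation coefficients it is the residual
  of the algorithm at step \<open>(k, l)\<close>. Its first column-major maximizer is \<open>(p\<^sub>k, q\<^sub>l)\<close>, so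
  the selected pairs form a grid.
\<close>

section \<open>Newton bases: triangular interpolation systems\<close>

text \<open>The maximality of the chosen points is left out on purpose: what remains is pure
  triangularity, which carries over to products of two families. The passage from \<open>f\<close>
  to \<open>r\<close> is unit triangular, and the values \<open>r k (p i)\<close> form a triangular
  array with nonzero diagonal.\<close>

definition newton_basis ::
    "(nat \<Rightarrow> 'a \<Rightarrow> 'b::field) \<Rightarrow> (nat \<Rightarrow> 'a \<Rightarrow> 'b) \<Rightarrow> (nat \<Rightarrow> 'a) \<Rightarrow> nat \<Rightarrow> bool" where
  "newton_basis f r p m \<longleftrightarrow> (\<forall>k<m.
     (\<exists>a. a k = 1 \<and> (\<forall>x. r k x = (\<Sum>i\<le>k. a i * f i x))) \<and>
     (\<forall>i<k. r k (p i) = 0) \<and> r k (p k) \<noteq> 0)"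

lemma newton_basis_comb:
  assumes "newton_basis f r p m" "k < m"
  obtains a where "a k = 1" "\<And>x. r k x = (\<Sum>i\<le>k. a i * f i x)"
  using assms unfolding newton_basis_def by blast

lemma newton_basis_zero: "newton_basis f r p m \<Longrightarrow> k < m \<Longrightarrow> i < k \<Longrightarrow> r k (p i) = 0"
  unfolding newton_basis_def by blast

lemma newton_basis_nonzero: "newton_basis f r p m \<Longrightarrow> k < m \<Longrightarrow> r k (p k) \<noteq> 0"
  unfolding newton_basis_def by blast

lemma newton_basis_mono: "newton_basis f r p m \<Longrightarrow> n \<le> m \<Longrightarrow> newton_basis f r p n"
  unfolding newton_basis_def by auto

text \<open>Newton's scheme: \<open>r n\<close> vanishes at the earlier points, so adding a multiple
  of it corrects the value at \<open>p n\<close> without disturbing the conditions already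
  met.\<close>

lemma newton_basis_interpolation:
  assumes "newton_basis f r p n"
  shows "\<exists>c. \<forall>j<n. (\<Sum>i<n. c i * f i (p j)) = h (p j)"
  using assms
proof (induction n)
  case 0
  then show ?case by simp
next
  case (Suc n)
  then obtain c where c: "\<And>j. j < n \<Longrightarrow> (\<Sum>i<n. c i * f i (p j)) = h (p j)"
    using newton_basis_mono[of f r p "Suc n" n] by auto
  obtain a where a: "\<And>x. r n x = (\<Sum>i\<le>n. a i * f i x)"
    using newton_basis_comb[OF Suc.prems, of n] by blast
  \<comment> \<open>The error of the old interpolant at the new point, scaled by the nonzero pivot
    \<open>r n (p n)\<close>.\<close>
  define d where "d = (h (p n) - (\<Sum>i<n. c i * f i (p n))) / r n (p n)"
  define c' where "c' i = (if i < n then c i else 0) + d * a i" for i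
  have c': "(\<Sum>i<Suc n. c' i * f i x) = (\<Sum>i<n. c i * f i x) + d * r n x" for x
    unfolding c'_def a lessThan_Suc_atMost[symmetric]
    by (simp add: algebra_simps sum.distrib sum_distrib_left)
  have "(\<Sum>i<Suc n. c' i * f i (p j)) = h (p j)" if "j < Suc n" for j
  proof (cases "j = n")
    case True
    then show ?thesis
      unfolding c' using newton_basis_nonzero[OF Suc.prems, of n] by (simp add: d_def)
  next
    case False
    then show ?thesis
      unfolding c' using that c newton_basis_zero[OF Suc.prems, of n j] by simp
  qed
  then show ?case by blast
qed

text \<open>Since \<open>a n = 1\<close>, the function \<open>f n\<close> can be traded for
  \<open>r n\<close>. At the earlier points \<open>r n\<close> vanishes, so the induction hypothesis
  kills the remaining coefficients; the value at \<open>p n\<close> then forces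
  \<open>c n = 0\<close>.\<close>

lemma newton_basis_unique:
  assumes "newton_basis f r p n"
    and "\<And>j. j < n \<Longrightarrow> (\<Sum>i<n. c i * f i (p j)) = 0"
    and "i < n"
  shows "c i = 0"
  using assms
proof (induction n arbitrary: c i)
  case 0
  then show ?case by simp
next
  case (Suc n)
  obtain a where a: "a n = 1" "\<And>x. r n x = (\<Sum>i\<le>n. a i * f i x)"
    using newton_basis_comb[OF Suc.prems(1), of n] by blast
  have eq: "(\<Sum>i<Suc n. c i * f i x) = c n * r n x + (\<Sum>i<n. (c i - c n * a i) * f i x)" for x
    unfolding a(2) lessThan_Suc_atMost[symmetric]
    by (simp add: a(1) algebra_simps sum_subtractf sum_distrib_left)
  have z: "c i - c n * a i = 0" if "i < n" for i
  proof (rule Suc.IH[OF _ _ that])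
    show "newton_basis f r p n"
      using Suc.prems(1) newton_basis_mono by fastforce
    show "(\<Sum>i<n. (c i - c n * a i) * f i (p j)) = 0" if "j < n" for j
      using eq[of "p j"] Suc.prems(2)[of j] newton_basis_zero[OF Suc.prems(1), of n j] that by simp
  qed
  then have "c n * r n (p n) = 0"
    using eq[of "p n"] Suc.prems(2)[of n] by simp
  then have "c n = 0"
    using newton_basis_nonzero[OF Suc.prems(1), of n] by simp
  with z[of i] Suc.prems(3) show ?case
    by (cases "i = n") auto
qed

text \<open>The greedy construction for an arbitrary selection rule \<open>sel\<close>. The rule
  only has to find a nonzero value of every combination with leading coefficient 1, and each
  residual has this form.\<close>

lemma newton_basis_exists:
  fixes f :: "nat \<Rightarrow> 'a \<Rightarrow> 'b::field"
  assumes "\<And>k a. k < m \<Longrightarrow> a k = 1 \<Longrightarrow>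
    \<exists>x. sel (\<lambda>y. \<Sum>i\<le>k. a i * f i y) x \<and> (\<Sum>i\<le>k. a i * f i x) \<noteq> 0"
  shows "\<exists>r p. newton_basis f r p m \<and> (\<forall>k<m. sel (r k) (p k))"
  using assms
proof (induction m)
  case 0
  then show ?case by (auto simp: newton_basis_def)
next
  case (Suc m)
  from Suc.IH[OF Suc.prems]
  obtain r p where nb: "newton_basis f r p m" and sel: "\<And>k. k < m \<Longrightarrow> sel (r k) (p k)"
    by auto
  obtain c where c: "\<And>j. j < m \<Longrightarrow> (\<Sum>i<m. c i * f i (p j)) = f m (p j)"
    using newton_basis_interpolation[OF nb] by blast
  \<comment> \<open>With these coefficients \<open>g\<close> is the error of interpolating
    \<open>f m\<close> at the earlier points, hence zero there.\<close>
  define a where "a i = (if i = m then 1 else - c i)" for i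
  define g where "g = (\<lambda>y. \<Sum>i\<le>m. a i * f i y)"
  obtain x where x: "sel g x" "g x \<noteq> 0"
    using Suc.prems[of m a] unfolding g_def a_def by auto
  have g: "g y = f m y - (\<Sum>i<m. c i * f i y)" for y
    unfolding g_def lessThan_Suc_atMost[symmetric] by (simp add: a_def sum_negf)
  have "newton_basis f (r(m := g)) (p(m := x)) (Suc m)"
    unfolding newton_basis_def
  proof (intro allI impI)
    fix k
    assume k: "k < Suc m"
    show "(\<exists>a. a k = 1 \<and> (\<forall>y. (r(m := g)) k y = (\<Sum>i\<le>k. a i * f i y))) \<and>
      (\<forall>i<k. (r(m := g)) k ((p(m := x)) i) = 0) \<and> (r(m := g)) k ((p(m := x)) k) \<noteq> 0"
    proof (cases "k = m")
      case True
      have "a m = 1" by (simp add: a_def)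
      then have "\<exists>a. a m = 1 \<and> (\<forall>y. g y = (\<Sum>i\<le>m. a i * f i y))"
        unfolding g_def by blast
      then show ?thesis using True x c by (auto simp: g)
    next
      case False
      then show ?thesis using nb k unfolding newton_basis_def by auto
    qed
  qed
  moreover have "\<forall>k<Suc m. sel ((r(m := g)) k) ((p(m := x)) k)"
    using sel x by (auto simp: less_Suc_eq)
  ultimately show ?case by blast
qed

text \<open>The index \<open>t\<close> enumerates the pairs \<open>(t div n, t mod n)\<close>
  lexicographically. Expanding the product of two combinations yields only pairs that are
  componentwise at most \<open>(k, l)\<close>, and none of these comes after
  \<open>t\<close>.\<close>

lemma newton_basis_product:
  fixes f :: "nat \<Rightarrow> 'a \<Rightarrow> 'c::field" and g :: "nat \<Rightarrow> 'b \<Rightarrow> 'c"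
  assumes f: "newton_basis f r p m" and g: "newton_basis g s q n"
  shows "newton_basis (\<lambda>t (x, y). f (t div n) x * g (t mod n) y)
    (\<lambda>t (x, y). r (t div n) x * s (t mod n) y) (\<lambda>t. (p (t div n), q (t mod n))) (m * n)"
  unfolding newton_basis_def
proof (intro allI impI)
  fix t
  assume t: "t < m * n"
  define k l where "k = t div n" and "l = t mod n"
  have n: "n > 0" using t by (cases n) auto
  have k: "k < m" and l: "l < n"
    using t n by (auto simp: k_def l_def less_mult_imp_div_less)
  have t_eq: "t = k * n + l" by (simp add: k_def l_def)
  obtain a where a: "a k = 1" "\<And>x. r k x = (\<Sum>i\<le>k. a i * f i x)"
    using newton_basis_comb[OF f k] by blast
  obtain b where b: "b l = 1" "\<And>x. s l x = (\<Sum>i\<le>l. b i * g i x)"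
    using newton_basis_comb[OF g l] by blast
  \<comment> \<open>Indices up to \<open>t\<close> can still have remainder above \<open>l\<close>
    in an earlier block; they lie outside the rectangle \<open>{..k} \<times> {..l}\<close> and get
    coefficient 0.\<close>
  define ab where "ab u = (if u mod n \<le> l then a (u div n) * b (u mod n) else 0)" for u
  have "r k x * s l y = (\<Sum>u\<le>t. ab u * (f (u div n) x * g (u mod n) y))" for x y
  proof -
    have "r k x * s l y = (\<Sum>(i, j)\<in>{..k} \<times> {..l}. (a i * f i x) * (b j * g j y))"
      by (simp add: a b sum_product sum.cartesian_product)
    also have "\<dots> = (\<Sum>u | u \<le> t \<and> u mod n \<le> l. ab u * (f (u div n) x * g (u mod n) y))"
    proof (rule sum.reindex_bij_witness[where i = "\<lambda>u. (u div n, u mod n)" and j = "\<lambda>(i, j). i * n + j"])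
      fix ij
      assume "ij \<in> {..k} \<times> {..l}"
      then obtain i j where ij: "ij = (i, j)" "i \<le> k" "j \<le> l" by auto
      then have j: "j < n" using l by simp
      then have dm: "(i * n + j) div n = i" "(i * n + j) mod n = j" using n by auto
      show "(case ij of (i, j) \<Rightarrow> i * n + j) \<in> {u. u \<le> t \<and> u mod n \<le> l}"
        using ij dm unfolding t_eq by (auto intro: add_mono)
      show "((case ij of (i, j) \<Rightarrow> i * n + j) div n, (case ij of (i, j) \<Rightarrow> i * n + j) mod n) = ij"
        using ij dm by auto
      show "ab (case ij of (i, j) \<Rightarrow> i * n + j) * (f ((case ij of (i, j) \<Rightarrow> i * n + j) div n) x *
          g ((case ij of (i, j) \<Rightarrow> i * n + j) mod n) y) =
        (case ij of (i, j) \<Rightarrow> a i * f i x * (b j * g j y))"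
        using ij dm by (auto simp: ab_def)
    next
      fix u
      assume u: "u \<in> {u. u \<le> t \<and> u mod n \<le> l}"
      then have "u div n \<le> k" by (auto simp: k_def intro: div_le_mono)
      with u show "(u div n, u mod n) \<in> {..k} \<times> {..l}" by auto
      show "(case (u div n, u mod n) of (i, j) \<Rightarrow> i * n + j) = u" by simp
    qed
    also have "\<dots> = (\<Sum>u\<le>t. ab u * (f (u div n) x * g (u mod n) y))"
      by (rule sum.mono_neutral_left) (auto simp: ab_def)
    finally show ?thesis .
  qed
  moreover have "ab t = 1"
    by (simp add: ab_def k_def[symmetric] l_def[symmetric] a b)
  \<comment> \<open>An earlier pair either shares the block \<open>k\<close> and has a smaller inner
    index, where the factor \<open>s l\<close> vanishes, or lies in an earlier block, where
    \<open>r k\<close> vanishes.\<close>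
  moreover have "r k (p (u div n)) * s l (q (u mod n)) = 0" if "u < t" for u
  proof (cases "u div n = k")
    case True
    then have "u mod n < l"
      using that div_mult_mod_eq[of u n] unfolding t_eq by (metis nat_add_left_cancel_less)
    then show ?thesis using newton_basis_zero[OF g l] by simp
  next
    case False
    then have "u div n < k"
      using that div_le_mono[of u t n] by (simp add: k_def)
    then show ?thesis using newton_basis_zero[OF f k] by simp
  qed
  moreover have "r k (p k) * s l (q l) \<noteq> 0"
    using newton_basis_nonzero[OF f k] newton_basis_nonzero[OF g l] by simp
  ultimately show "(\<exists>a. a t = 1 \<and> (\<forall>x. (case x of (x, y) \<Rightarrow> r (t div n) x * s (t mod n) y) =
        (\<Sum>i\<le>t. a i * (case x of (x, y) \<Rightarrow> f (i div n) x * g (i mod n) y)))) \<and>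
      (\<forall>i<t. (case (p (i div n), q (i mod n)) of (x, y) \<Rightarrow> r (t div n) x * s (t mod n) y) = 0) \<and>
      (case (p (t div n), q (t mod n)) of (x, y) \<Rightarrow> r (t div n) x * s (t mod n) y) \<noteq> 0"
    unfolding k_def[symmetric] l_def[symmetric] by auto
qed

section \<open>First maximizers of the absolute value\<close>

definition first_abs_max :: "nat \<Rightarrow> (nat \<Rightarrow> real) \<Rightarrow> nat \<Rightarrow> bool" where
  "first_abs_max n h i \<longleftrightarrow> i < n \<and> (\<forall>x<n. \<bar>h x\<bar> \<le> \<bar>h i\<bar>) \<and> (\<forall>x<i. \<bar>h x\<bar> < \<bar>h i\<bar>)"

lemma first_abs_max_exists:
  assumes "x < n" "h x \<noteq> 0"
  shows "\<exists>i. first_abs_max n h i \<and> h i \<noteq> 0"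
proof -
  define P where "P i \<longleftrightarrow> i < n \<and> (\<forall>x<n. \<bar>h x\<bar> \<le> \<bar>h i\<bar>)" for i
  have "Max ((\<lambda>i. \<bar>h i\<bar>) ` {..<n}) \<in> (\<lambda>i. \<bar>h i\<bar>) ` {..<n}"
    using assms by (intro Max_in) auto
  then obtain i where "i < n" "Max ((\<lambda>i. \<bar>h i\<bar>) ` {..<n}) = \<bar>h i\<bar>" by auto
  then have "P i" unfolding P_def by (metis Max_ge finite_imageI finite_lessThan imageI lessThan_iff)
  then have L: "P (LEAST i. P i)" by (rule LeastI)
  have "\<bar>h y\<bar> < \<bar>h (LEAST i. P i)\<bar>" if "y < (LEAST i. P i)" for y
  proof -
    have "y < n" using L that unfolding P_def by linarith
    moreover have "\<not> P y" using that by (rule not_less_Least)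
    ultimately show ?thesis using L unfolding P_def by (meson not_le order_trans)
  qed
  moreover have "h (LEAST i. P i) \<noteq> 0" using L assms unfolding P_def by fastforce
  ultimately show ?thesis using L unfolding first_abs_max_def P_def by blast
qed

text \<open>Absolute values multiply, so the two maximizations separate. A column before
  \<open>j\<close> falls strictly short because \<open>g i\<close> is nonzero, and within column
  \<open>j\<close> a row before \<open>i\<close> falls strictly short because \<open>h j\<close> is
  nonzero; this matches the column-major tie-breaking.\<close>

lemma abs_argmax_rank_one:
  assumes i: "first_abs_max n1 g i" and j: "first_abs_max n2 h j"
    and nz: "g i \<noteq> 0" "h j \<noteq> 0"
  shows "abs_argmax (mat n1 n2 (\<lambda>(x, y). g x * h y)) = (i, j)"
proof -
  define A where "A = mat n1 n2 (\<lambda>(x, y). g x * h y)"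
  have ij: "i < n1" "j < n2" using i j by (auto simp: first_abs_max_def)
  have max: "(i, j) \<in> abs_maximizers A"
    using i j by (auto simp: abs_maximizers_def A_def first_abs_max_def abs_mult intro!: mult_mono)
  have D: "x < n1" "y < n2" "\<bar>g i\<bar> * \<bar>h j\<bar> \<le> \<bar>g x\<bar> * \<bar>h y\<bar>" if "(x, y) \<in> abs_maximizers A" for x y
    using that ij by (auto simp: abs_maximizers_def A_def abs_mult)
  have "(LEAST y. \<exists>x. (x, y) \<in> abs_maximizers A) = j"
  proof (rule Least_equality)
    show "\<exists>x. (x, j) \<in> abs_maximizers A" using max by blast
    fix y
    assume "\<exists>x. (x, y) \<in> abs_maximizers A"
    then obtain x where x: "(x, y) \<in> abs_maximizers A" ..
    show "j \<le> y"
    proof (rule ccontr)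
      assume "\<not> j \<le> y"
      then have "\<bar>h y\<bar> < \<bar>h j\<bar>" using j by (simp add: first_abs_max_def)
      moreover have "\<bar>g x\<bar> \<le> \<bar>g i\<bar>" using i D(1)[OF x] by (simp add: first_abs_max_def)
      ultimately have "\<bar>g x\<bar> * \<bar>h y\<bar> < \<bar>g i\<bar> * \<bar>h j\<bar>"
        using nz by (meson abs_ge_zero le_less_trans mult_right_mono mult_strict_left_mono zero_less_abs_iff)
      with D(3)[OF x] show False by simp
    qed
  qed
  moreover have "(LEAST x. (x, j) \<in> abs_maximizers A) = i"
  proof (rule Least_equality)
    show "(i, j) \<in> abs_maximizers A" by (rule max)
    fix x
    assume x: "(x, j) \<in> abs_maximizers A"
    show "i \<le> x"
    proof (rule ccontr)
      assume "\<not> i \<le> x"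
      then have "\<bar>g x\<bar> < \<bar>g i\<bar>" using i by (simp add: first_abs_max_def)
      with D(3)[OF x] nz show False by simp
    qed
  qed
  ultimately show ?thesis unfolding A_def[symmetric] abs_argmax_def Let_def by simp
qed

section \<open>Greedy selection on independent columns\<close>

text \<open>If every entry were zero, the coefficients padded with zeros up to length
  \<open>m\<close> would be a nonzero kernel vector of \<open>A\<close>, a linear dependence of its
  columns.\<close>

lemma lin_indpt_cols_comb_nonzero:
  fixes A :: "real mat"
  assumes A: "A \<in> carrier_mat n m" and ind: "lin_indpt_cols A"
    and k: "k < m" and nz: "a k \<noteq> 0"
  shows "\<exists>x<n. (\<Sum>i\<le>k. a i * col A i $ x) \<noteq> 0"
proof (rule ccontr)
  assume "\<not> ?thesis"
  then have z: "(\<Sum>i\<le>k. a i * col A i $ x) = 0" if "x < n" for x using that by blast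
  define v where "v = vec m (\<lambda>i. if i \<le> k then a i else 0)"
  have v: "v \<in> carrier_vec m" by (simp add: v_def)
  have "v $ k \<noteq> 0" using k nz by (simp add: v_def)
  then have v0: "v \<noteq> 0\<^sub>v m" using k by auto
  have "A *\<^sub>v v = 0\<^sub>v n"
  proof (rule eq_vecI)
    fix x
    assume "x < dim_vec (0\<^sub>v n)"
    then have x: "x < n" by simp
    have "(A *\<^sub>v v) $ x = (\<Sum>i<m. A $$ (x, i) * (if i \<le> k then a i else 0))"
      using A x by (auto simp: scalar_prod_def v_def lessThan_atLeast0 intro!: sum.cong)
    also have "\<dots> = (\<Sum>i\<le>k. A $$ (x, i) * (if i \<le> k then a i else 0))"
      using k by (intro sum.mono_neutral_right) auto
    also have "\<dots> = (\<Sum>i\<le>k. a i * col A i $ x)"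
      using A x k by (intro sum.cong) auto
    finally show "(A *\<^sub>v v) $ x = 0\<^sub>v n $ x" using z x by simp
  qed (use A in simp)
  from vec_space.lin_depI[OF A v v0 this] ind A show False
    by (auto simp: lin_indpt_cols_def)
qed

lemma newton_basis_cols:
  fixes A :: "real mat"
  assumes "A \<in> carrier_mat n m" and "lin_indpt_cols A"
  obtains r p where "newton_basis (\<lambda>k x. col A k $ x) r p m"
    and "\<And>k. k < m \<Longrightarrow> first_abs_max n (r k) (p k)"
proof -
  have "\<exists>x. first_abs_max n (\<lambda>y. \<Sum>i\<le>k. a i * col A i $ y) x \<and> (\<Sum>i\<le>k. a i * col A i $ x) \<noteq> 0"
    if "k < m" "a k = 1" for k and a :: "nat \<Rightarrow> real"
    using lin_indpt_cols_comb_nonzero[OF assms that(1), of a] that(2)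
      first_abs_max_exists[of _ n "\<lambda>y. \<Sum>i\<le>k. a i * col A i $ y"] by auto
  \<comment> \<open>The rule \<open>sel\<close> becomes the first maximizer; its nonzero value comes
    from linear independence.\<close>
  from newton_basis_exists[of m "first_abs_max n", OF this] show ?thesis
    using that by blast
qed

section \<open>The run of TEIM on the product grid\<close>

context
  fixes U V :: "real mat" and m1 m2 n1 n2 :: nat
    and r s :: "nat \<Rightarrow> nat \<Rightarrow> real" and p q :: "nat \<Rightarrow> nat"
  assumes U: "U \<in> carrier_mat n1 m1" and V: "V \<in> carrier_mat n2 m2"
    and nb_U: "newton_basis (\<lambda>k x. col U k $ x) r p m1"
    and nb_V: "newton_basis (\<lambda>k x. col V k $ x) s q m2"
    and max_U: "\<And>k. k < m1 \<Longrightarrow> first_abs_max n1 (r k) (p k)"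
    and max_V: "\<And>k. k < m2 \<Longrightarrow> first_abs_max n2 (s k) (q k)"
begin

private definition F :: "nat \<Rightarrow> nat \<times> nat \<Rightarrow> real" where
  "F t = (\<lambda>(x, y). col U (t div m2) $ x * col V (t mod m2) $ y)"

private definition R :: "nat \<Rightarrow> nat \<times> nat \<Rightarrow> real" where
  "R t = (\<lambda>(x, y). r (t div m2) x * s (t mod m2) y)"

private definition pt :: "nat \<Rightarrow> nat \<times> nat" where
  "pt t = (p (t div m2), q (t mod m2))"

private lemma nb: "newton_basis F R pt (m1 * m2)"
  using newton_basis_product[OF nb_U nb_V] unfolding F_def R_def pt_def .

private lemma bounds:
  assumes "t < m1 * m2"
  shows "t div m2 < m1" "t mod m2 < m2" "fst (pt t) < n1" "snd (pt t) < n2"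
proof -
  show dm: "t div m2 < m1" "t mod m2 < m2"
    using assms by (auto simp: less_mult_imp_div_less intro!: mod_less_divisor gr0I)
  show "fst (pt t) < n1" "snd (pt t) < n2"
    using max_U[OF dm(1)] max_V[OF dm(2)] by (auto simp: pt_def first_abs_max_def)
qed

private lemma teim_mat_index: "i < n1 \<Longrightarrow> j < n2 \<Longrightarrow> teim_mat U V t $$ (i, j) = F t (i, j)"
  using U V by (simp add: teim_mat_def F_def)

private lemma teim_mat_pt: "u < m1 * m2 \<Longrightarrow> teim_mat U V t $$ pt u = F t (pt u)"
  using teim_mat_index bounds(3,4) by (metis prod.collapse)

text \<open>\<open>R t\<close> is \<open>F t\<close> plus a combination of earlier
  \<open>F i\<close> and vanishes at the earlier points, so its coefficients solve the interpolation
  system, which has only one solution.\<close>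

private lemma teim_residual_eq:
  assumes t: "t < m1 * m2"
  shows "teim_residual U V t (map pt [0..<t]) = mat n1 n2 (R t)"
proof -
  obtain a where a: "a t = 1" "\<And>x. R t x = (\<Sum>i\<le>t. a i * F i x)"
    using newton_basis_comb[OF nb t] by blast
  have Rt: "R t x = F t x + (\<Sum>i<t. a i * F i x)" for x
    unfolding a(2) lessThan_Suc_atMost[symmetric] using a(1) by simp
  have nbt: "newton_basis F R pt t" using newton_basis_mono[OF nb] t by simp
  have solves: "(\<Sum>i<t. F i (pt u) * - a i) = F t (pt u)" if "u < t" for u
    using newton_basis_zero[OF nb t that] by (simp add: Rt sum_negf mult.commute)
  \<comment> \<open>The sign is reversed because the algorithm subtracts the interpolant.
    Solvability is \<open>solves\<close>; uniqueness follows by applying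
    \<open>newton_basis_unique\<close> to the difference of two solutions.\<close>
  have "teim_coeffs U V t (map pt [0..<t]) = vec t (\<lambda>i. - a i)"
    unfolding teim_coeffs_def
  proof (rule the_equality)
    show "vec t (\<lambda>i. - a i) \<in> carrier_vec t \<and> (\<forall>u<t. (\<Sum>i<t. teim_mat U V i $$ (map pt [0..<t] ! u) *
        vec t (\<lambda>i. - a i) $ i) = teim_mat U V t $$ (map pt [0..<t] ! u))"
      using t solves by (auto simp: teim_mat_pt)
  next
    fix c
    assume c: "c \<in> carrier_vec t \<and> (\<forall>u<t. (\<Sum>i<t. teim_mat U V i $$ (map pt [0..<t] ! u) * c $ i) =
        teim_mat U V t $$ (map pt [0..<t] ! u))"
    have "(\<Sum>i<t. (c $ i + a i) * F i (pt u)) = 0" if "u < t" for u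
    proof -
      have "(\<Sum>i<t. F i (pt u) * c $ i) = F t (pt u)"
        using c that t by (auto simp: teim_mat_pt)
      with solves[OF that] show ?thesis
        by (simp add: algebra_simps sum.distrib sum_negf)
    qed
    from newton_basis_unique[OF nbt this]
    have "c $ i = - a i" if "i < t" for i using that by (simp add: eq_neg_iff_add_eq_0)
    then show "c = vec t (\<lambda>i. - a i)" using c by auto
  qed
  then show ?thesis
    using U V by (intro eq_matI) (auto simp: teim_residual_def teim_mat_index Rt sum_negf)
qed

private lemma abs_argmax_R:
  assumes "t < m1 * m2"
  shows "abs_argmax (mat n1 n2 (R t)) = pt t"
  unfolding R_def pt_def using bounds[OF assms]
  by (intro abs_argmax_rank_one max_U max_V newton_basis_nonzero[OF nb_U] newton_basis_nonzero[OF nb_V])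

private lemma teim_indices_pt: "t \<le> m1 * m2 \<Longrightarrow> teim_indices U V t = map pt [0..<t]"
proof (induction t)
  case 0
  then show ?case by simp
next
  case (Suc t)
  then have "t < m1 * m2" by simp
  note step = abs_argmax_R[OF this] teim_residual_eq[OF this]
  show ?case
  proof (cases t)
    case 0
    \<comment> \<open>The first selection has its own clause in \<open>teim_indices\<close>; it
      agrees with the general step because the sum over no earlier matrices is empty.\<close>
    have "teim_mat U V 0 = teim_residual U V 0 []"
      by (intro eq_matI) (auto simp: teim_residual_def teim_mat_def)
    then show ?thesis using step 0 by simp
  next
    case t': (Suc t')
    then show ?thesis using step Suc by (simp add: Let_def)
  qed
qed

lemma teim_indices_eq:
  "t \<le> m1 * m2 \<Longrightarrow> teim_indices U V t = map (\<lambda>t. (p (t div m2), q (t mod m2))) [0..<t]"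
  using teim_indices_pt unfolding pt_def .

end

section \<open>Kronecker factorization of the selection matrices\<close>

theorem theorem1:
  fixes U V :: "real mat" and m1 m2 n1 n2 :: nat
  assumes "1 \<le> m1" and "m1 \<le> n1" and "1 \<le> m2" and "m2 \<le> n2"
    and "U \<in> carrier_mat n1 m1" and "V \<in> carrier_mat n2 m2"
    and "lin_indpt_cols U" and "lin_indpt_cols V"
  shows "\<exists>P3 \<in> carrier_mat m1 n1. \<exists>P4 \<in> carrier_mat m2 n2.
    khatri_rao (transpose_mat (teim_P1 U V)) (transpose_mat (teim_P2 U V)) =
      kron_mat (transpose_mat P3) (transpose_mat P4) \<and>
    (\<forall>i < m1. col (transpose_mat P3) i = col (transpose_mat (teim_P1 U V)) (i * m2)) \<and>
    (\<forall>j < m2. col (transpose_mat P4) j = col (transpose_mat (teim_P2 U V)) j)"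
proof -
  note U = assms(5) and V = assms(6)
  obtain r p where rp: "newton_basis (\<lambda>k x. col U k $ x) r p m1"
    "\<And>k. k < m1 \<Longrightarrow> first_abs_max n1 (r k) (p k)"
    using newton_basis_cols[OF U assms(7)] by blast
  obtain s q where sq: "newton_basis (\<lambda>k x. col V k $ x) s q m2"
    "\<And>k. k < m2 \<Longrightarrow> first_abs_max n2 (s k) (q k)"
    using newton_basis_cols[OF V assms(8)] by blast
  have idx: "teim_indices U V (m1 * m2) = map (\<lambda>t. (p (t div m2), q (t mod m2))) [0..<m1 * m2]"
    using teim_indices_eq[OF U V rp(1) sq(1) rp(2) sq(2)] by simp
  \<comment> \<open>On the grid, column \<open>t\<close> of \<open>Q1\<close> depends only on
    \<open>t div m2\<close> and that of \<open>Q2\<close> only on \<open>t mod m2\<close>.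
    \<open>Q3\<close> and \<open>Q4\<close> keep one copy of each column, and their transposes are
    the witnesses.\<close>
  define Q1 where "Q1 = mat_of_cols n1 (map (\<lambda>t. unit_vec n1 (p (t div m2)) :: real vec) [0..<m1 * m2])"
  define Q2 where "Q2 = mat_of_cols n2 (map (\<lambda>t. unit_vec n2 (q (t mod m2)) :: real vec) [0..<m1 * m2])"
  define Q3 where "Q3 = mat_of_cols n1 (map (\<lambda>i. unit_vec n1 (p i) :: real vec) [0..<m1])"
  define Q4 where "Q4 = mat_of_cols n2 (map (\<lambda>j. unit_vec n2 (q j) :: real vec) [0..<m2])"
  have P1: "transpose_mat (teim_P1 U V) = Q1" and P2: "transpose_mat (teim_P2 U V) = Q2"
    using U V by (simp_all add: teim_P1_def teim_P2_def Q1_def Q2_def idx comp_def)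
  have Q: "Q1 \<in> carrier_mat n1 (m1 * m2)" "Q2 \<in> carrier_mat n2 (m1 * m2)"
    "Q3 \<in> carrier_mat n1 m1" "Q4 \<in> carrier_mat n2 m2"
    by (auto simp: Q1_def Q2_def Q3_def Q4_def)
  have col1: "col Q1 t = unit_vec n1 (p (t div m2))" "col Q2 t = unit_vec n2 (q (t mod m2))"
    if "t < m1 * m2" for t
    using that by (auto simp: Q1_def Q2_def)
  have col3: "col Q3 i = unit_vec n1 (p i)" if "i < m1" for i
    using that by (auto simp: Q3_def)
  have col4: "col Q4 j = unit_vec n2 (q j)" if "j < m2" for j
    using that by (auto simp: Q4_def)
  have "khatri_rao Q1 Q2 = kron_mat Q3 Q4"
  proof (rule eq_matI)
    fix i j
    assume "i < dim_row (kron_mat Q3 Q4)" "j < dim_col (kron_mat Q3 Q4)"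
    then have i: "i < n1 * n2" and j: "j < m1 * m2" using Q by (auto simp: kron_mat_def)
    have im: "i div n2 < n1" "i mod n2 < n2"
      using i by (auto simp: less_mult_imp_div_less intro!: mod_less_divisor gr0I)
    have jm: "j div m2 < m1" "j mod m2 < m2"
      using j assms(3) by (auto simp: less_mult_imp_div_less)
    have "khatri_rao Q1 Q2 $$ (i, j) = col Q1 j $ (i div n2) * col Q2 j $ (i mod n2)"
      using Q i j by (simp add: khatri_rao_def kron_vec_def mat_of_cols_index)
    \<comment> \<open>The quotient and remainder that index the grid are exactly those by which the
      Kronecker product splits its column index.\<close>
    also have "\<dots> = col Q3 (j div m2) $ (i div n2) * col Q4 (j mod m2) $ (i mod n2)"
      using j jm by (simp add: col1 col3 col4)
    also have "\<dots> = kron_mat Q3 Q4 $$ (i, j)"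
      using Q i j im jm by (simp add: kron_mat_def)
    finally show "khatri_rao Q1 Q2 $$ (i, j) = kron_mat Q3 Q4 $$ (i, j)" .
  qed (use Q in \<open>auto simp: khatri_rao_def kron_mat_def\<close>)
  moreover have "col Q3 i = col Q1 (i * m2)" if "i < m1" for i
  proof -
    \<comment> \<open>The 0-based column \<open>i * m2\<close> opens block \<open>i\<close>, so its
      quotient by \<open>m2\<close> is \<open>i\<close>.\<close>
    have "i * m2 < m1 * m2" using that assms(3) by simp
    then show ?thesis using that assms(3) by (simp add: col1 col3)
  qed
  moreover have "col Q4 j = col Q2 j" if "j < m2" for j
  proof -
    have "j < m1 * m2" using that assms(1) by (metis less_le_trans mult_le_mono1 nat_mult_1)
    then show ?thesis using that by (simp add: col1 col4)
  qed
  ultimately show ?thesis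
    unfolding P1 P2 using Q
    by (intro bexI[of _ "transpose_mat Q3"] bexI[of _ "transpose_mat Q4"]) auto
qed

end
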